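(* Let $t\in\mathbb{N}$ be arbitrary. Then the finite monoid $M_2(K^{\infty}_t)$ of $2\times 2$ matrices over the finite min-plus semiring $K^{\infty}_t=\{0,1,\ldots,t,\infty\}$ is generated by the $t+4$ matrices $$A_i=\begin{pmatrix} i & 0\\ 0 & \infty\end{pmatrix}\ (i\in\{0,1,\ldots,t,\infty\}),\qquad B=\begin{pmatrix} 1 & \infty\\ \infty & 0\end{pmatrix},\qquad C=\begin{pmatrix} \infty & \infty\\ \infty & 0\end{pmatrix}.$$
   Context: $\mathbb{N}=\{0,1,2,\ldots\}$. The min-plus semiring $K^{\infty}$ is $\mathbb{N}\cup\{\infty\}$ with $\oplus=\min$ and $\otimes=+$ (with $x\otimes\infty=\infty\otimes x=\infty$ for all $x$). For $t\in\mathbb{N}$, $K^{\infty}_t$ is the quotient of $K^{\infty}$ by the least semiring congruence identifying $t$ and $t+1$. Explicitly, $K^{\infty}_t=\{0,1,\ldots,t,\infty\}$ with $a\oplus b=\min\{a,b\}$ (where $\infty$ is the largest element), $a\otimes b=\min\{a+b,t\}$ if $a,b\neq\infty$, and $a\otimes b=\infty$ if $a=\infty$ or $b=\infty$. Its multiplicative identity is the number $0$ and its additive identity is $\infty$. $M_2(K^{\infty}_t)$ is the monoid of all $2\times 2$ matrices with entries in $K^{\infty}_t$ under matrix multiplication with respect to $\oplus$ and $\otimes$, i.e. $(XY)_{pq}=(X_{p1}\otimes Y_{1q})\oplus(X_{p2}\otimes Y_{2q})$; its identity is $\begin{pmatrix} 0&\infty\\ \infty&0\end{pmatrix}$. The entries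 $0,1,i$ in the matrices of the claim denote (the images in $K^{\infty}_t$ of) the corresponding natural numbers or $\infty$, not the zero and one of the semiring; in particular the entry $1$ of $B$ is the image of the natural number $1$, that is $\min\{1,t\}$, which equals $0$ when $t=0$. *)

theory Defs
  imports
    "HOL-Analysis.Analysis"
    "HOL-Algebra.Ring"
    "HOL-Library.Extended_Nat"
begin

text \<open>
  The quotient map from the min-plus semiring on \<open>\<nat> \<union> {\<infinity>}\<close> to its truncation at \<^term>\<open>t\<close>:
  every natural number above \<^term>\<open>t\<close> is identified with \<^term>\<open>t\<close>, while \<open>\<infinity>\<close> is left alone.
\<close>

definition trunc :: "nat \<Rightarrow> enat \<Rightarrow> enat" where
  "trunc t x = (if x = \<infinity> then \<infinity> else min x (enat t))"

text \<open>
  Beware that the semiring zero is \<open>\<infinity>\<close> and the semiring one is the number 0. The usual \<^const>\<open>plus\<close>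
  of \<^typ>\<open>enat\<close> is the multiplication.
\<close>

definition minplus :: "nat \<Rightarrow> enat ring" where
  "minplus t = \<lparr>carrier = insert \<infinity> (enat ` {0..t}),
                mult = (\<lambda>a b. if a = \<infinity> \<or> b = \<infinity> then \<infinity> else min (a + b) (enat t)),
                one = 0,
                zero = \<infinity>,
                add = min\<rparr>"

lemma minplus_simps:
  "carrier (minplus t) = insert \<infinity> (enat ` {0..t})"
  "a \<otimes>\<^bsub>minplus t\<^esub> b = (if a = \<infinity> \<or> b = \<infinity> then \<infinity> else min (a + b) (enat t))"
  "\<one>\<^bsub>minplus t\<^esub> = 0"
  "\<zero>\<^bsub>minplus t\<^esub> = \<infinity>"
  "a \<oplus>\<^bsub>minplus t\<^esub> b = min a b"
  by (simp_all add: minplus_def)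

lemma carrier_minplus_iff: "x \<in> carrier (minplus t) \<longleftrightarrow> x = \<infinity> \<or> x \<le> enat t"
  by (cases x) (auto simp: minplus_simps)

lemma trunc_in_carrier: "trunc t x \<in> carrier (minplus t)"
  by (auto simp: carrier_minplus_iff trunc_def)

lemma semiring_minplus: "semiring (minplus t)"
proof (unfold_locales, goal_cases)
  case (1 x y) then show ?case by (auto simp: carrier_minplus_iff minplus_simps min_def)
next
  case (2 x y z) then show ?case by (simp add: minplus_simps min.assoc)
next
  case 3 show ?case by (simp add: carrier_minplus_iff minplus_simps)
next
  case (4 x) then show ?case by (simp add: minplus_simps)
next
  case (5 x) then show ?case by (simp add: minplus_simps)
next
  case (6 x y) then show ?case by (simp add: minplus_simps min.commute)
next
  case (7 x y) then show ?case by (auto simp: carrier_minplus_iff minplus_simps)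
next
  case (8 x y z) then show ?case
    by (cases x; cases y; cases z) (auto simp: minplus_simps min_def)
next
  case 9 show ?case by (simp add: minplus_simps zero_enat_def)
next
  case (10 x) then show ?case by (auto simp: carrier_minplus_iff minplus_simps min_def)
next
  case (11 x) then show ?case by (auto simp: carrier_minplus_iff minplus_simps min_def)
next
  case (12 x y z) then show ?case
    by (cases x; cases y; cases z) (auto simp: minplus_simps min_def)
next
  case (13 x y z) then show ?case
    by (cases x; cases y; cases z) (auto simp: minplus_simps min_def)
next
  case (14 x) then show ?case by (simp add: minplus_simps)
next
  case (15 x) then show ?case by (simp add: minplus_simps)
qed

text \<open>
  The type-class based matrix product of \<open>HOL-Analysis\<close> would use the ordinary addition and
  multiplication of \<^typ>\<open>enat\<close>, so the product is written out over the operations of \<open>R\<close>.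
\<close>

definition mat2_monoid :: "('a, 'm) ring_scheme \<Rightarrow> ('a ^ 2 ^ 2) monoid" where
  "mat2_monoid R =
     \<lparr>carrier = {X. \<forall>p q. X $ p $ q \<in> carrier R},
      mult = (\<lambda>X Y. \<chi> p q. (X $ p $ 1 \<otimes>\<^bsub>R\<^esub> Y $ 1 $ q) \<oplus>\<^bsub>R\<^esub> (X $ p $ 2 \<otimes>\<^bsub>R\<^esub> Y $ 2 $ q)),
      one = (\<chi> p q. if p = q then \<one>\<^bsub>R\<^esub> else \<zero>\<^bsub>R\<^esub>)\<rparr>"

lemma monoid_mat2_monoid:
  assumes "semiring R"
  shows "monoid (mat2_monoid R)"
proof -
  interpret semiring R by fact
  show ?thesis
  proof (unfold_locales, goal_cases)
    case (2 X Y Z)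
    then show ?case
      by (simp add: mat2_monoid_def vec_eq_iff l_distr r_distr m_assoc a_ac)
  qed (auto simp: mat2_monoid_def vec_eq_iff forall_2)
qed

definition mat2 :: "'a \<Rightarrow> 'a \<Rightarrow> 'a \<Rightarrow> 'a \<Rightarrow> 'a ^ 2 ^ 2" where
  "mat2 a b c d = (\<chi> p q. if p = 1 then (if q = 1 then a else b) else (if q = 1 then c else d))"

lemma mat2_nth [simp]:
  "mat2 a b c d $ 1 $ 1 = a" "mat2 a b c d $ 1 $ 2 = b"
  "mat2 a b c d $ 2 $ 1 = c" "mat2 a b c d $ 2 $ 2 = d"
  by (simp_all add: mat2_def)

lemma mat2_eq_iff: "mat2 a b c d = mat2 a' b' c' d' \<longleftrightarrow> a = a' \<and> b = b' \<and> c = c' \<and> d = d'"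
  by (auto simp: vec_eq_iff forall_2)

definition genA :: "enat \<Rightarrow> enat ^ 2 ^ 2" where
  "genA i = mat2 i 0
                 0 \<infinity>"

text \<open>The entry 1 is the image of the natural number 1, which is 0 in case \<^prop>\<open>t = 0\<close>.\<close>

definition genB :: "nat \<Rightarrow> enat ^ 2 ^ 2" where
  "genB t = mat2 (trunc t 1) \<infinity>
                 \<infinity>           0"

definition genC :: "enat ^ 2 ^ 2" where
  "genC = mat2 \<infinity> \<infinity>
               \<infinity> 0"

definition gens :: "nat \<Rightarrow> (enat ^ 2 ^ 2) set" where
  "gens t = genA ` carrier (minplus t) \<union> {genB t, genC}"

lemma card_gens: "card (gens t) = t + 4"
proof -
  have "inj_on genA (carrier (minplus t))"
    by (simp add: inj_on_def genA_def mat2_eq_iff)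
  then have "card (genA ` carrier (minplus t)) = t + 2"
    by (auto simp: card_image minplus_simps card_insert_if inj_on_def)
  moreover have "genA ` carrier (minplus t) \<inter> {genB t, genC} = {}"
    by (auto simp: genA_def genB_def genC_def mat2_eq_iff)
  moreover have "genB t \<noteq> genC"
    by (simp add: genB_def genC_def mat2_eq_iff trunc_def min_def one_enat_def)
  moreover have "finite (carrier (minplus t))"
    by (simp add: minplus_simps)
  ultimately show ?thesis
    by (simp add: gens_def card_Un_disjoint)
qed

lemma gens_subset: "gens t \<subseteq> carrier (mat2_monoid (minplus t))"
  using trunc_in_carrier[of t 1]
  by (auto simp: gens_def mat2_monoid_def forall_2 genA_def genB_def genC_def
      carrier_minplus_iff)

lemma finite_mat2_monoid_minplus: "finite (carrier (mat2_monoid (minplus t)))"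
proof (rule finite_subset)
  let ?K = "carrier (minplus t)"
  let ?f = "\<lambda>(a, b, c, d). mat2 a b c d"
  show "carrier (mat2_monoid (minplus t)) \<subseteq> ?f ` (?K \<times> ?K \<times> ?K \<times> ?K)"
  proof
    fix X assume "X \<in> carrier (mat2_monoid (minplus t))"
    then show "X \<in> ?f ` (?K \<times> ?K \<times> ?K \<times> ?K)"
      by (intro image_eqI[of _ _ "(X $ 1 $ 1, X $ 1 $ 2, X $ 2 $ 1, X $ 2 $ 2)"])
        (simp_all add: mat2_monoid_def vec_eq_iff forall_2)
  qed
  show "finite (?f ` (?K \<times> ?K \<times> ?K \<times> ?K))"
    by (simp add: minplus_simps)
qed

text \<open>The library's \<open>generate\<close> also closes under inverses, so it cannot be used here.\<close>

definition monoid_generate :: "('a, 'm) monoid_scheme \<Rightarrow> 'a set \<Rightarrow> 'a set" where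
  "monoid_generate M S = (\<lambda>H. submonoid H M) hull S"

end

theory Submission
  imports Defs
begin

text \<open>
  Idea of the proof. The generator \<open>A\<^sub>\<infinity>\<close> is the permutation matrix of the transposition.
  Powers of \<open>B\<close>, the matrix \<open>C\<close> and conjugation by \<open>A\<^sub>\<infinity>\<close> give all diagonal matrices.
  Hence a submonoid \<open>H\<close> that contains the generators is closed under exchanging and under scaling
  rows and columns (scaling means adding a constant). Moreover
  \<open>A\<^sub>i A\<^sub>\<infinity>\<close> and \<open>A\<^sub>\<infinity> A\<^sub>i\<close> are the upper and lower unitriangular matrices with entry \<open>i\<close>,
  so \<open>H\<close> contains every matrix that has an upper-diagonal-lower factorisation.

  Given an arbitrary matrix, exchange rows and columns until a least entry stands in the lower right
  corner, and factor that entry out. This leaves a matrix with lower right entry 0, the semiring one,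
  and first row \<open>(a, b)\<close>, lower left entry \<open>c\<close>. Its upper-diagonal-lower factorisation would force
  the upper left entry to be \<open>min x (b + c)\<close> with \<open>x\<close> on the diagonal, which is possible exactly
  if \<open>a \<le> b + c\<close> (lemma \<open>upper_diag_lower_mem\<close>). If instead \<open>b + c \<le> a\<close>,
  then scaling the first row by \<open>b\<close> and the first column by \<open>c\<close> reduces
  to the matrix with upper left entry \<open>e = a - (b + c)\<close> and zeros elsewhere, and exchanging its rows
  yields a matrix of the first kind (lemma \<open>lower_right_zero_mem\<close>).
\<close>

section \<open>Arithmetic of the truncated semiring\<close>

lemma minplus_mult_eq_trunc: "a \<otimes>\<^bsub>minplus t\<^esub> b = trunc t (a + b)"
  by (simp add: minplus_simps trunc_def plus_eq_infty_iff_enat)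

lemma trunc_carrier [simp]: "x \<in> carrier (minplus t) \<Longrightarrow> trunc t x = x"
  by (auto simp: carrier_minplus_iff trunc_def min_def)

lemma trunc_infinity [simp]: "trunc t \<infinity> = \<infinity>"
  by (simp add: trunc_def)

lemma trunc_trunc_plus: "trunc t (trunc t x + y) = trunc t (x + y)"
  by (cases x; cases y) (auto simp: trunc_def min_def)

lemma zero_in_carrier [simp]: "0 \<in> carrier (minplus t)"
  by (simp add: carrier_minplus_iff)

lemma infinity_in_carrier [simp]: "\<infinity> \<in> carrier (minplus t)"
  by (simp add: carrier_minplus_iff)

text \<open>
  Since a finite difference is at most the minuend, dividing one entry by a smaller one stays
  inside the semiring, and multiplying back by \<open>x\<close> causes no truncation. If \<open>y = \<infinity>\<close>, then \<open>\<infinity>\<close> is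
  a quotient for every \<open>x\<close>, so finite and infinite entries can be treated alike below.
\<close>

lemma carrier_minplus_le_obtains_difference:
  assumes "x \<le> y" "y \<in> carrier (minplus t)"
  obtains z where "z \<in> carrier (minplus t)" "y = x + z"
proof (cases "y = \<infinity>")
  case True
  then show ?thesis using that[of \<infinity>] by simp
next
  case False
  obtain z where z: "y = x + z" using assms(1) by (auto simp: le_iff_add)
  then have "z \<le> y" by simp
  with False assms(2) have "z \<in> carrier (minplus t)"
    using order.trans by (auto simp: carrier_minplus_iff)
  with z that show ?thesis by blast
qed

section \<open>Two-by-two matrices\<close>

lemma mat2_eta: "mat2 (X $ 1 $ 1) (X $ 1 $ 2) (X $ 2 $ 1) (X $ 2 $ 2) = X"
  by (simp add: vec_eq_iff forall_2)

lemma mat2_mult: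
  "mat2 a b c d \<otimes>\<^bsub>mat2_monoid (minplus t)\<^esub> mat2 a' b' c' d' =
     mat2 (min (trunc t (a + a')) (trunc t (b + c'))) (min (trunc t (a + b')) (trunc t (b + d')))
          (min (trunc t (c + a')) (trunc t (d + c'))) (min (trunc t (c + b')) (trunc t (d + d')))"
  by (simp add: mat2_monoid_def vec_eq_iff forall_2 minplus_mult_eq_trunc)
    (simp add: minplus_simps)

lemma mat2_one: "\<one>\<^bsub>mat2_monoid (minplus t)\<^esub> = mat2 0 \<infinity> \<infinity> 0"
  by (simp add: mat2_monoid_def vec_eq_iff forall_2 minplus_simps)

lemma submonoid_carrier:
  assumes "monoid M"
  shows "submonoid (carrier M) M"
proof -
  interpret monoid M by fact
  show ?thesis by unfold_locales auto
qed

section \<open>Submonoids containing the generators\<close>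

context
  fixes t :: nat and H :: "(enat ^ 2 ^ 2) set"
  assumes sub: "submonoid H (mat2_monoid (minplus t))"
    and gens: "gens t \<subseteq> H"
begin

lemma mult_mem: "X \<in> H \<Longrightarrow> Y \<in> H \<Longrightarrow> X \<otimes>\<^bsub>mat2_monoid (minplus t)\<^esub> Y \<in> H"
  using sub by (rule submonoid.m_closed)

lemma mat2_entries_carrier:
  assumes "mat2 a b c d \<in> H"
  shows "a \<in> carrier (minplus t)" "b \<in> carrier (minplus t)"
    "c \<in> carrier (minplus t)" "d \<in> carrier (minplus t)"
proof -
  have "mat2 a b c d \<in> carrier (mat2_monoid (minplus t))"
    using submonoid.subset[OF sub] assms by blast
  then show "a \<in> carrier (minplus t)" "b \<in> carrier (minplus t)"
    "c \<in> carrier (minplus t)" "d \<in> carrier (minplus t)"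
    by (simp_all add: mat2_monoid_def forall_2)
qed

lemma genA_mem: "i \<in> carrier (minplus t) \<Longrightarrow> mat2 i 0 0 \<infinity> \<in> H"
  using gens by (auto simp: gens_def genA_def)

lemma swap_rows_mem:
  assumes "mat2 a b c d \<in> H"
  shows "mat2 c d a b \<in> H"
  using mult_mem[OF genA_mem[of \<infinity>] assms] mat2_entries_carrier[OF assms]
  by (simp add: mat2_mult)

lemma swap_columns_mem:
  assumes "mat2 a b c d \<in> H"
  shows "mat2 b a d c \<in> H"
  using mult_mem[OF assms genA_mem[of \<infinity>]] mat2_entries_carrier[OF assms]
  by (simp add: mat2_mult)

lemma upper_unitriangular_mem: "i \<in> carrier (minplus t) \<Longrightarrow> mat2 0 i \<infinity> 0 \<in> H"
  by (rule swap_columns_mem) (rule genA_mem)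

lemma lower_unitriangular_mem: "i \<in> carrier (minplus t) \<Longrightarrow> mat2 0 \<infinity> i 0 \<in> H"
  by (rule swap_rows_mem) (rule genA_mem)

text \<open>
  The powers of \<open>B\<close> provide the finite values. The value \<open>\<infinity>\<close> is not reached by powers,
  which is why \<open>C\<close> is among the generators.
\<close>

lemma diag_zero_mem:
  assumes "i \<in> carrier (minplus t)"
  shows "mat2 i \<infinity> \<infinity> 0 \<in> H"
proof (cases i)
  case infinity
  then show ?thesis using gens by (auto simp: gens_def genC_def)
next
  case (enat n)
  have B: "mat2 (trunc t 1) \<infinity> \<infinity> 0 \<in> H"
    using gens by (auto simp: gens_def genB_def)
  have "n \<le> t \<Longrightarrow> mat2 (enat n) \<infinity> \<infinity> 0 \<in> H" for n
  proof (induction n)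
    case 0
    show ?case using submonoid.one_closed[OF sub] by (simp add: mat2_one zero_enat_def)
  next
    case (Suc n)
    have "trunc t (trunc t 1 + enat n) = enat (Suc n)"
      using Suc.prems by (simp add: trunc_def one_enat_def min_def)
    with mult_mem[OF B Suc.IH] Suc.prems show ?case by (simp add: mat2_mult)
  qed
  with enat assms show ?thesis by (simp add: carrier_minplus_iff)
qed

lemma diag_mem:
  assumes "i \<in> carrier (minplus t)" "j \<in> carrier (minplus t)"
  shows "mat2 i \<infinity> \<infinity> j \<in> H"
proof -
  have "mat2 0 \<infinity> \<infinity> j \<in> H"
    by (rule swap_rows_mem[OF swap_columns_mem[OF diag_zero_mem[OF assms(2)]]])
  from mult_mem[OF diag_zero_mem[OF assms(1)] this] assms show ?thesis
    by (simp add: mat2_mult)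
qed

lemma scale_rows_mem:
  assumes "mat2 a b c d \<in> H" "r \<in> carrier (minplus t)" "s \<in> carrier (minplus t)"
  shows "mat2 (trunc t (r + a)) (trunc t (r + b)) (trunc t (s + c)) (trunc t (s + d)) \<in> H"
  using mult_mem[OF diag_mem[OF assms(2,3)] assms(1)] by (simp add: mat2_mult)

lemma scale_columns_mem:
  assumes "mat2 a b c d \<in> H" "r \<in> carrier (minplus t)" "s \<in> carrier (minplus t)"
  shows "mat2 (trunc t (a + r)) (trunc t (b + s)) (trunc t (c + r)) (trunc t (d + s)) \<in> H"
  using mult_mem[OF assms(1) diag_mem[OF assms(2,3)]] by (simp add: mat2_mult)

section \<open>Factoring an arbitrary matrix\<close>

text \<open>
  In the product of the upper unitriangular matrix with entry \<open>b\<close>, the diagonal matrix with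
  entries \<open>a\<close> and 0, and the lower unitriangular matrix with entry \<open>c\<close>, the upper left entry is
  \<open>min a (b + c)\<close>, truncated; the hypothesis makes this equal to \<open>a\<close>.
\<close>

lemma upper_diag_lower_mem:
  assumes "a \<in> carrier (minplus t)" "b \<in> carrier (minplus t)" "c \<in> carrier (minplus t)"
    and "a \<le> b + c"
  shows "mat2 a b c 0 \<in> H"
proof -
  have "mat2 a b \<infinity> 0 \<in> H"
    using mult_mem[OF upper_unitriangular_mem[OF assms(2)] diag_zero_mem[OF assms(1)]] assms
    by (simp add: mat2_mult)
  from mult_mem[OF this lower_unitriangular_mem[OF assms(3)]]
  have "mat2 (min a (trunc t (b + c))) b c 0 \<in> H"
    using assms by (simp add: mat2_mult)
  moreover have "min a (trunc t (b + c)) = a"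
    using assms by (auto simp: trunc_def carrier_minplus_iff min_def)
  ultimately show ?thesis by simp
qed

text \<open>
  If \<open>b + c \<le> a\<close>, write \<open>a = b + c + e\<close>. The matrix is then obtained by adding \<open>b\<close> to the first
  row and \<open>c\<close> to the first column of the matrix with upper left entry \<open>e\<close> and all other entries 0.
  Exchanging the rows of that matrix moves \<open>e\<close> off the diagonal, where the condition for an
  upper-diagonal-lower factorisation becomes \<open>0 \<le> 0 + e\<close>.
\<close>

lemma lower_right_zero_mem:
  assumes "a \<in> carrier (minplus t)" "b \<in> carrier (minplus t)" "c \<in> carrier (minplus t)"
  shows "mat2 a b c 0 \<in> H"
proof (cases "a \<le> b + c")
  case True
  with assms show ?thesis by (rule upper_diag_lower_mem)
next
  case False
  then have "b + c \<le> a" by simp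
  then obtain e where e: "e \<in> carrier (minplus t)" "a = b + c + e"
    using carrier_minplus_le_obtains_difference assms(1) by blast
  have "mat2 0 0 e 0 \<in> H"
    using e(1) by (intro upper_diag_lower_mem) auto
  then have "mat2 e 0 0 0 \<in> H" by (rule swap_rows_mem)
  from scale_rows_mem[OF this assms(2) zero_in_carrier]
  have "mat2 (trunc t (b + e)) b 0 0 \<in> H" using assms by simp
  from scale_columns_mem[OF this assms(3) zero_in_carrier]
  have "mat2 (trunc t (trunc t (b + e) + c)) b c 0 \<in> H" using assms by simp
  moreover have "b + e + c = a" using e(2) by (simp add: ac_simps)
  then have "trunc t (trunc t (b + e) + c) = a"
    using assms(1) by (simp add: trunc_trunc_plus)
  ultimately show ?thesis by simp
qed

lemma lower_right_least_mem:
  assumes K: "a \<in> carrier (minplus t)" "b \<in> carrier (minplus t)" "c \<in> carrier (minplus t)"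
      "d \<in> carrier (minplus t)"
    and least: "d \<le> a" "d \<le> b" "d \<le> c"
  shows "mat2 a b c d \<in> H"
proof -
  obtain a' where a': "a' \<in> carrier (minplus t)" "a = d + a'"
    using carrier_minplus_le_obtains_difference least(1) K(1) by blast
  obtain b' where b': "b' \<in> carrier (minplus t)" "b = d + b'"
    using carrier_minplus_le_obtains_difference least(2) K(2) by blast
  obtain c' where c': "c' \<in> carrier (minplus t)" "c = d + c'"
    using carrier_minplus_le_obtains_difference least(3) K(3) by blast
  have "mat2 a' b' c' 0 \<in> H"
    using a' b' c' by (intro lower_right_zero_mem)
  from scale_rows_mem[OF this K(4) K(4)] show ?thesis
    using K a' b' c' by simp
qed

lemma carrier_subset_of_gens_subset: "carrier (mat2_monoid (minplus t)) \<subseteq> H"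
proof
  fix X assume "X \<in> carrier (mat2_monoid (minplus t))"
  moreover define a b c d
    where "a = X $ 1 $ 1" "b = X $ 1 $ 2" "c = X $ 2 $ 1" "d = X $ 2 $ 2"
  ultimately have K: "a \<in> carrier (minplus t)" "b \<in> carrier (minplus t)"
      "c \<in> carrier (minplus t)" "d \<in> carrier (minplus t)"
    and X: "X = mat2 a b c d"
    by (simp_all add: mat2_monoid_def mat2_eta)
  consider "d \<le> a" "d \<le> b" "d \<le> c" | "c \<le> a" "c \<le> b" "c \<le> d"
    | "b \<le> a" "b \<le> c" "b \<le> d" | "a \<le> b" "a \<le> c" "a \<le> d"
    using linear[of a b] linear[of c d] linear[of a c] linear[of a d] linear[of b c] linear[of b d]
    by (blast intro: order.trans)
  then have "mat2 a b c d \<in> H"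
  proof cases
    case 1
    with K show ?thesis by (intro lower_right_least_mem)
  next
    case 2
    with K show ?thesis by - (rule swap_columns_mem[OF lower_right_least_mem])
  next
    case 3
    with K show ?thesis by - (rule swap_rows_mem[OF lower_right_least_mem])
  next
    case 4
    with K show ?thesis by - (rule swap_rows_mem[OF swap_columns_mem[OF lower_right_least_mem]])
  qed
  with X show "X \<in> H" by simp
qed

end

section \<open>The generated submonoid\<close>

theorem corollary1p2:
  fixes t :: nat
  shows "monoid_generate (mat2_monoid (minplus t)) (gens t) = carrier (mat2_monoid (minplus t))"
  unfolding monoid_generate_def
proof (rule hull_unique)
  show "gens t \<subseteq> carrier (mat2_monoid (minplus t))"
    by (rule gens_subset)
  show "submonoid (carrier (mat2_monoid (minplus t))) (mat2_monoid (minplus t))"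
    by (intro submonoid_carrier monoid_mat2_monoid semiring_minplus)
  show "carrier (mat2_monoid (minplus t)) \<subseteq> H"
    if "gens t \<subseteq> H" "submonoid H (mat2_monoid (minplus t))" for H
    using that by (intro carrier_subset_of_gens_subset)
qed

end
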